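(* For every integer $n\ge 1$, $$(-1)^{n+1}(2n+1)!\left(2-2^{-2n}\right)\frac{\zeta(2n+1)}{(2\pi)^{2n+1}}=\int_0^1 B_{2n+1}\left(\frac{1-t}{2}\right)\frac{dt}{\sin\pi t},$$ where $\zeta$ is the Riemann zeta function.
   Context: The Bernoulli polynomials $B_m(x)$ are defined by $\frac{t e^{xt}}{e^t-1}=\sum_{m=0}^\infty B_m(x)\frac{t^m}{m!}$ for $|t|<2\pi$. *)

theory Defs
  imports "HOL-Complex_Analysis.Complex_Analysis"
begin

text \<open>
  The generating function \<open>t e\<^sup>x\<^sup>t / (e\<^sup>t - 1)\<close> has a removable singularity at \<open>t = 0\<close>, where the
  HOL quotient has the spurious value \<open>0\<close>; hence the point \<open>t = 0\<close> is left out.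
\<close>

definition bernoulli_gf :: "real \<Rightarrow> (nat \<Rightarrow> real) \<Rightarrow> bool" where
  "bernoulli_gf x b \<longleftrightarrow>
     (\<forall>t::complex. t \<noteq> 0 \<and> norm t < 2 * pi \<longrightarrow>
        (\<lambda>m. of_real (b m) * (t ^ m / fact m)) sums (t * exp (of_real x * t) / (exp t - 1)))"

definition bernoulli_poly :: "nat \<Rightarrow> real \<Rightarrow> real" where
  "bernoulli_poly m x = (THE b. bernoulli_gf x b) m"

lemma bernoulli_gf_exists: "\<exists>b. bernoulli_gf x b"
proof -
  define D where "D = (fps_exp 1 - 1 :: real fps)"
  define N where "N = (fps_X * fps_exp x :: real fps)"
  define F where "F = N / D"
  define c where "c = (\<lambda>G::real fps. Abs_fps (\<lambda>n. complex_of_real (fps_nth G n)))"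
  have c_mult: "c (G * H) = c G * c H" for G H
    by (simp add: c_def fps_eq_iff fps_mult_nth)
  have D1: "fps_nth D 1 \<noteq> 0" and D0: "fps_nth D 0 = 0" by (simp_all add: D_def)
  have subD: "subdegree D = 1" using D0 D1 by (intro subdegreeI) auto
  have "subdegree N = 1"
    by (simp add: N_def)
  hence "D dvd N" using subD D1
    by (subst fps_dvd_iff) auto
  hence FD: "F * D = N" by (simp add: F_def)
  have cD: "c D = fps_exp 1 - 1"
    by (simp add: c_def D_def fps_eq_iff)
  have cN: "c N = fps_X * fps_exp (of_real x)"
    by (auto simp add: c_def N_def fps_eq_iff)
  have FD': "c F * (fps_exp 1 - 1) = fps_X * fps_exp (of_real x)"
    using c_mult[of F D] FD cD cN by simp
  define g where "g = (\<lambda>t::complex. if t = 0 then 1 else t * exp (of_real x * t) / (exp t - 1))"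
  have sub1: "subdegree (fps_exp 1 - 1 :: complex fps) = 1"
    by (intro subdegreeI) auto
  have nz: "(fps_exp 1 - 1 :: complex fps) \<noteq> 0" using sub1 by auto
  have exp0: "exp t \<noteq> 1" if "t \<noteq> 0" "norm t < 2 * pi" for t :: complex
  proof
    assume "exp t = 1"
    then obtain n :: int where n: "Re t = 0" "Im t = of_int (2 * n) * pi"
      by (auto simp: exp_eq_1)
    with that(1) have "n \<noteq> 0" by (auto simp: complex_eq_iff)
    hence "1 \<le> \<bar>real_of_int n\<bar>" by linarith
    moreover have "norm t = 2 * pi * \<bar>real_of_int n\<bar>"
      using n by (simp add: cmod_eq_Im abs_mult)
    ultimately show False using that(2) pi_gt_zero
      by (metis mult.right_neutral mult_le_cancel_left_pos not_le zero_less_mult_iff zero_less_numeral)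
  qed
  have cF: "c F = (fps_X * fps_exp (of_real x)) / (fps_exp 1 - 1)"
    using FD' nz by (metis nonzero_mult_div_cancel_right)
  have exp': "(\<lambda>t. t * exp (of_real x * t)) has_fps_expansion (fps_X * fps_exp (of_real x :: complex))"
    and exp'': "(\<lambda>t. exp t - 1) has_fps_expansion (fps_exp 1 - 1 :: complex fps)"
    using has_fps_expansion_exp[of "1::complex"]
    by (auto intro!: fps_expansion_intros)
  have cF0: "fps_nth (c F) 0 = 1"
  proof -
    have "fps_nth (c F * (fps_exp 1 - 1)) 1 = fps_nth (fps_X * fps_exp (of_real x :: complex)) 1"
      using FD' by simp
    thus ?thesis by (simp add: fps_mult_nth)
  qed
  have gexp: "g has_fps_expansion c F"
    unfolding cF g_def
    by (rule has_fps_expansion_divide [OF exp' exp'']) (use sub1 cF cF0 nz in \<open>auto simp: fps_divide_nth_0\<close>)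
  have ho: "g holomorphic_on eball 0 (ereal (2 * pi))"
  proof -
    have "(\<lambda>t::complex. t * exp (of_real x * t) / (exp t - 1)) holomorphic_on (ball 0 (2*pi) - {0})"
      using exp0 by (intro holomorphic_intros) auto
    hence h: "g holomorphic_on (ball 0 (2*pi) - {0})"
      by (rule holomorphic_transform) (auto simp: g_def)
    have "g analytic_on {0}" using gexp by (rule has_fps_expansion_imp_analytic_0)
    hence "isCont g 0" by (simp add: analytic_at_imp_isCont)
    hence lim: "(g \<longlongrightarrow> g 0) (at 0 within ball 0 (2*pi))"
      using continuous_at_imp_continuous_at_within continuous_within by blast
    have "g holomorphic_on ball 0 (2*pi)"
      by (rule no_isolated_singularity'[OF _ h]) (use lim in simp_all)
    thus ?thesis by simp
  qed
  have "bernoulli_gf x (\<lambda>m. fact m * fps_nth F m)"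
    unfolding bernoulli_gf_def
  proof (intro allI impI)
    fix t :: complex assume t: "t \<noteq> 0 \<and> norm t < 2 * pi"
    have "(\<lambda>n. fps_nth (c F) n * t ^ n) sums g t"
      using has_fps_expansion_imp_sums_complex[OF gexp ho] t by simp
    thus "(\<lambda>m. of_real (fact m * fps_nth F m) * (t ^ m / fact m)) sums
           (t * exp (of_real x * t) / (exp t - 1))"
      using t by (simp add: g_def c_def)
  qed
  thus ?thesis by blast
qed

lemma bernoulli_gf_unique:
  assumes "bernoulli_gf x b" "bernoulli_gf x b'"
  shows "b = b'"
proof
  fix m
  define a where "a = (\<lambda>m. complex_of_real (b m - b' m) / fact m)"
  have sums: "(\<lambda>n. a n * t ^ n) sums 0" if "t \<noteq> 0" "norm t < 2 * pi" for t
  proof -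
    let ?g = "t * exp (of_real x * t) / (exp t - 1)"
    have "(\<lambda>n. of_real (b n) * (t ^ n / fact n)) sums ?g"
         "(\<lambda>n. of_real (b' n) * (t ^ n / fact n)) sums ?g"
      using assms that by (simp_all add: bernoulli_gf_def)
    from sums_diff[OF this] show ?thesis
      by (simp add: a_def algebra_simps diff_divide_distrib)
  qed
  have "((\<lambda>_. 0) \<longlongrightarrow> a 0) (at (0::complex))"
    by (rule powser_limit_0_strong[of "2 * pi"]) (use sums in auto)
  hence a0: "a 0 = 0" by (simp add: tendsto_const_iff)
  have sums': "(\<lambda>n. a n * (t - 0) ^ n) sums 0" if "norm (t - 0) < 2 * pi" for t
    using sums[of t] that a0 powser_sums_zero[of a] by (cases "t = 0") auto
  have "a m = 0"
  proof (rule ccontr)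
    assume *: "a m \<noteq> 0"
    with a0 have "m > 0" by (cases m) auto
    obtain s where s: "0 < s" "\<And>z::complex. z \<in> cball 0 s - {0} \<Longrightarrow> (0::complex) \<noteq> 0"
      by (rule powser_0_nonzero[of "2 * pi" 0 a "\<lambda>_. 0" m]) (use sums' * \<open>m > 0\<close> in auto)
    show False using s(2)[of "of_real s"] s(1) by simp
  qed
  thus "b m = b' m" by (simp add: a_def)
qed

lemma bernoulli_gf_bernoulli_poly: "bernoulli_gf x (\<lambda>m. bernoulli_poly m x)"
  unfolding bernoulli_poly_def
  using theI'[of "bernoulli_gf x"] bernoulli_gf_exists bernoulli_gf_unique by blast

text \<open>
  The Dirichlet series only represents the Riemann zeta function for \<open>s > 1\<close>; for other arguments
  the value is meaningless.
\<close>

definition zeta :: "real \<Rightarrow> real" where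
  "zeta s = (\<Sum>k. 1 / real (Suc k) powr s)"

end

theory Submission
  imports Defs "HOL-Real_Asymp.Real_Asymp"
begin

text \<open>
  Put \<open>f t = B\<^bsub>2n+1\<^esub>((1 - t) / 2)\<close>. The cosecant behaves like the divergent series
  \<open>2 \<Sum> sin ((2 j + 1) \<pi> t)\<close>: its partial sums satisfy
  \<open>1 / sin \<theta> = 2 (\<Sum>j<N. sin ((2 j + 1) \<theta>)) + cos (2 N \<theta>) / sin \<theta>\<close>
  (\<open>sin_odd_multiples_sum\<close>). Multiplying by \<open>f\<close> and integrating leaves the remainder
  \<open>\<integral> f t / sin (\<pi> t) * cos (2 N \<pi> t) dt\<close>. Since \<open>B\<^bsub>2n+1\<^esub>\<close> vanishes at \<open>1 / 2\<close> by its
  reflection symmetry, and at \<open>0\<close> because \<open>n \<ge> 1\<close>, the quotient \<open>f t / sin (\<pi> t)\<close> extends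
  continuously to \<open>[0, 1]\<close>, so the remainder tends to \<open>0\<close> by the Riemann-Lebesgue lemma.
  Hence the integral of \<open>f t / sin (\<pi> t)\<close> is twice the sum of the sine coefficients of \<open>f\<close>
  with odd index (\<open>cosecant_integral_sums\<close>).

  For odd \<open>k\<close> the \<open>k\<close>-th sine coefficient is found by integrating by parts twice, which lowers the
  index of the Bernoulli polynomial by two (\<open>bernoulli_sine_coefficient\<close>): it equals
  \<open>(-1)\<^bsup>n+1\<^esup> (2n+1)! / (2 \<pi> k)\<^bsup>2n+1\<^esup>\<close>. Summing over odd \<open>k\<close> produces the odd part
  \<open>(1 - 2\<^bsup>-(2n+1)\<^esup>) \<zeta>(2n+1)\<close> of the zeta series, and the factor \<open>2\<close> turns the
  coefficient in front into \<open>2 - 2\<^bsup>-2n\<^esup>\<close>.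

  The facts about Bernoulli polynomials are all read off from the generating function: an operation on
  \<open>t e\<^sup>x\<^sup>t / (e\<^sup>t - 1)\<close> that is visible on power series becomes, by uniqueness of the coefficients,
  an identity for \<open>B\<^sub>m\<close>.
\<close>

section \<open>Bernoulli polynomials\<close>

lemma bernoulli_poly_eqI:
  assumes "bernoulli_gf x b"
  shows "bernoulli_poly m x = b m"
  using bernoulli_gf_unique[OF assms bernoulli_gf_bernoulli_poly] by simp

lemma bernoulli_poly_sums:
  fixes t :: complex
  assumes "t \<noteq> 0" "norm t < 2 * pi"
  shows "(\<lambda>m. of_real (bernoulli_poly m x) * (t ^ m / fact m)) sums
           (t * exp (of_real x * t) / (exp t - 1))"
  using bernoulli_gf_bernoulli_poly[of x] assms by (simp add: bernoulli_gf_def)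

lemma exp_neq_1_in_disc:
  fixes t :: complex
  assumes "t \<noteq> 0" "norm t < 2 * pi"
  shows "exp t \<noteq> 1"
proof
  assume *: "exp t = 1"
  obtain n :: int where n: "Re t = 0" "Im t = of_int (2 * n) * pi"
    using * by (auto simp: exp_eq_1)
  with assms(1) have "n \<noteq> 0" by (auto simp: complex_eq_iff)
  hence "1 \<le> \<bar>real_of_int n\<bar>" by linarith
  moreover have "norm t = 2 * pi * \<bar>real_of_int n\<bar>"
    using n by (simp add: cmod_eq_Im abs_mult)
  ultimately show False using assms(2) pi_gt_zero
    by (metis mult.right_neutral mult_le_cancel_left_pos not_le zero_less_mult_iff zero_less_numeral)
qed

text \<open>
  This is the Cauchy product of the series of \<open>t / (e\<^sup>t - 1)\<close> and of \<open>e\<^sup>x\<^sup>t\<close>. It shows that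
  \<open>B\<^sub>m\<close> is a polynomial function, and so gives access to its derivative.
\<close>

lemma bernoulli_poly_expand:
  "bernoulli_poly m x = (\<Sum>i\<le>m. real (m choose i) * bernoulli_poly i 0 * x ^ (m - i))"
proof (rule bernoulli_poly_eqI, unfold bernoulli_gf_def, intro allI impI)
  fix t :: complex
  assume t: "t \<noteq> 0 \<and> norm t < 2 * pi"
  define a where "a = (\<lambda>m. complex_of_real (bernoulli_poly m 0) * (t ^ m / fact m))"
  define e where "e = (\<lambda>m. (of_real x * t) ^ m /\<^sub>R fact m)"
  have a_sums: "a sums (t / (exp t - 1))"
    using bernoulli_poly_sums[of t 0] t by (simp add: a_def)
  have e_sums: "e sums exp (of_real x * t)"
    unfolding e_def by (rule exp_converges)
  \<comment> \<open>Convergence at a point of larger modulus within the disc yields absolute convergence at \<open>t\<close>.\<close>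
  define r where "r = (norm t + 2 * pi) / 2"
  have r: "0 < r" "r < 2 * pi" "norm t < r"
    using t by (auto simp: r_def field_simps add_pos_pos)
  have "summable (\<lambda>m. complex_of_real (bernoulli_poly m 0) / fact m * of_real r ^ m)"
    using sums_summable[OF bernoulli_poly_sums[of "of_real r" 0]] r by (simp add: mult_ac)
  hence "summable (\<lambda>m. norm (complex_of_real (bernoulli_poly m 0) / fact m * t ^ m))"
    by (rule powser_insidea) (use r in simp)
  hence a_abs: "summable (\<lambda>m. norm (a m))"
    by (simp add: a_def)
  have e_abs: "summable (\<lambda>m. norm (e m))"
    unfolding e_def by (rule summable_norm_exp)
  have "(\<lambda>m. \<Sum>i\<le>m. a i * e (m - i)) sums (t / (exp t - 1) * exp (of_real x * t))"
    using Cauchy_product_sums[OF a_abs e_abs] a_sums e_sums by (simp add: sums_iff)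
  moreover have "(\<Sum>i\<le>m. a i * e (m - i)) =
      of_real (\<Sum>i\<le>m. real (m choose i) * bernoulli_poly i 0 * x ^ (m - i)) * (t ^ m / fact m)" for m
    unfolding of_real_sum sum_distrib_right
  proof (rule sum.cong[OF refl])
    fix i assume "i \<in> {..m}"
    hence i: "i \<le> m" by simp
    hence "t ^ m = t ^ i * t ^ (m - i)" by (simp flip: power_add)
    thus "a i * e (m - i) =
        of_real (real (m choose i) * bernoulli_poly i 0 * x ^ (m - i)) * (t ^ m / fact m)"
      using binomial_fact[OF i, where 'a = complex]
      by (simp add: a_def e_def scaleR_conv_of_real power_mult_distrib field_simps)
  qed
  ultimately show "(\<lambda>m. of_real (\<Sum>i\<le>m. real (m choose i) * bernoulli_poly i 0 * x ^ (m - i)) *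
      (t ^ m / fact m)) sums (t * exp (of_real x * t) / (exp t - 1))"
    by simp
qed

lemma has_real_derivative_bernoulli_poly:
  "(bernoulli_poly (Suc m) has_real_derivative real (Suc m) * bernoulli_poly m x) (at x)"
proof -
  have "((\<lambda>x. \<Sum>i\<le>Suc m. real (Suc m choose i) * bernoulli_poly i 0 * x ^ (Suc m - i))
      has_real_derivative
      (\<Sum>i\<le>Suc m. real (Suc m choose i) * bernoulli_poly i 0 * (real (Suc m - i) * x ^ (Suc m - i - 1)))) (at x)"
    by (rule DERIV_sum) (auto intro!: derivative_eq_intros)
  also have "(\<Sum>i\<le>Suc m. real (Suc m choose i) * bernoulli_poly i 0 * (real (Suc m - i) * x ^ (Suc m - i - 1)))
      = (\<Sum>i\<le>m. real (Suc m choose i) * bernoulli_poly i 0 * (real (Suc m - i) * x ^ (m - i)))"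
    by simp
  also have "\<dots> = (\<Sum>i\<le>m. real (Suc m) * (real (m choose i) * bernoulli_poly i 0 * x ^ (m - i)))"
  proof (rule sum.cong[OF refl])
    fix i
    have "real (Suc m - i) * real (Suc m choose i) = real (Suc m) * real (m choose i)"
      using binomial_absorb_comp[of "Suc m" i] by (metis diff_Suc_1 of_nat_mult)
    hence "real (Suc m - i) * real (Suc m choose i) * (bernoulli_poly i 0 * x ^ (m - i)) =
        real (Suc m) * real (m choose i) * (bernoulli_poly i 0 * x ^ (m - i))"
      by (simp only:)
    thus "real (Suc m choose i) * bernoulli_poly i 0 * (real (Suc m - i) * x ^ (m - i)) =
        real (Suc m) * (real (m choose i) * bernoulli_poly i 0 * x ^ (m - i))"
      by (simp only: mult_ac)
  qed
  also have "\<dots> = real (Suc m) * bernoulli_poly m x"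
    by (simp only: bernoulli_poly_expand[of m x] sum_distrib_left)
  also have "(\<lambda>x. \<Sum>i\<le>Suc m. real (Suc m choose i) * bernoulli_poly i 0 * x ^ (Suc m - i)) = bernoulli_poly (Suc m)"
    by (rule ext) (simp only: bernoulli_poly_expand[of "Suc m"])
  finally show ?thesis .
qed

text \<open>
  The two generating functions differ by \<open>t (e\<^sup>t - 1) / (e\<^sup>t - 1) = t\<close>.
\<close>

lemma bernoulli_poly_1_arg:
  "bernoulli_poly m 1 = bernoulli_poly m 0 + (if m = 1 then 1 else 0)"
proof (rule bernoulli_poly_eqI, unfold bernoulli_gf_def, intro allI impI)
  fix t :: complex
  assume t: "t \<noteq> 0 \<and> norm t < 2 * pi"
  have "(\<lambda>m. of_real (bernoulli_poly m 0) * (t ^ m / fact m) + (if m = 1 then t ^ m / fact m else 0))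
      sums (t * exp (of_real 0 * t) / (exp t - 1) + t ^ 1 / fact 1)"
    by (intro sums_add bernoulli_poly_sums sums_single) (use t in auto)
  also have "t * exp (of_real 0 * t) / (exp t - 1) + t ^ 1 / fact 1 = t * exp (of_real 1 * t) / (exp t - 1)"
    using exp_neq_1_in_disc[of t] t by (simp add: field_simps)
  also have "(\<lambda>m. of_real (bernoulli_poly m 0) * (t ^ m / fact m) + (if m = 1 then t ^ m / fact m else 0))
     = (\<lambda>m. of_real (bernoulli_poly m 0 + (if m = 1 then 1 else 0)) * (t ^ m / fact m))"
    by (auto simp: fun_eq_iff algebra_simps)
  finally show "(\<lambda>m. of_real (bernoulli_poly m 0 + (if m = 1 then 1 else 0)) * (t ^ m / fact m))
      sums (t * exp (of_real 1 * t) / (exp t - 1))" .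
qed

text \<open>
  Replacing \<open>t\<close> by \<open>-t\<close> in the generating function at \<open>x\<close> gives the generating function at \<open>1 - x\<close>.
\<close>

lemma bernoulli_poly_reflect:
  "bernoulli_poly m (1 - x) = (-1) ^ m * bernoulli_poly m x"
proof (rule bernoulli_poly_eqI, unfold bernoulli_gf_def, intro allI impI)
  fix t :: complex
  assume t: "t \<noteq> 0 \<and> norm t < 2 * pi"
  have "(\<lambda>m. of_real (bernoulli_poly m x) * ((-t) ^ m / fact m)) sums
      (- t * exp (of_real x * (-t)) / (exp (-t) - 1))"
    by (rule bernoulli_poly_sums) (use t in auto)
  also have "(\<lambda>m. of_real (bernoulli_poly m x) * ((-t) ^ m / fact m)) =
      (\<lambda>m. of_real ((-1) ^ m * bernoulli_poly m x) * (t ^ m / fact m))"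
    by (simp add: power_minus[of t] fun_eq_iff)
  also have "- t * exp (of_real x * (-t)) / (exp (-t) - 1) =
      t * exp (of_real (1 - x) * t) / (exp t - 1)"
  proof -
    have "exp (of_real (1 - x) * t) = exp t * exp (of_real x * (-t))"
      by (simp add: algebra_simps flip: exp_add)
    thus ?thesis
      using exp_neq_1_in_disc[of t] t by (simp add: exp_minus field_simps)
  qed
  finally show "(\<lambda>m. of_real ((-1) ^ m * bernoulli_poly m x) * (t ^ m / fact m)) sums
      (t * exp (of_real (1 - x) * t) / (exp t - 1))" .
qed

lemma bernoulli_poly_odd_half:
  assumes "odd m"
  shows "bernoulli_poly m (1 / 2) = 0"
  using bernoulli_poly_reflect[of m "1 / 2"] assms by simp

lemma bernoulli_poly_odd_0:
  assumes "odd m" "m \<noteq> 1"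
  shows "bernoulli_poly m 0 = 0"
  using bernoulli_poly_reflect[of m 0] bernoulli_poly_1_arg[of m] assms by simp

text \<open>
  The generating function is not evaluated at \<open>t = 0\<close>, so the constant coefficient is obtained from
  the jump \<open>B\<^sub>1(1) - B\<^sub>1(0) = 1\<close> instead.
\<close>

lemma bernoulli_poly_0: "bernoulli_poly 0 x = 1"
proof -
  have "bernoulli_poly 1 1 = bernoulli_poly 1 0 + bernoulli_poly 0 0"
    by (subst bernoulli_poly_expand) (simp add: atMost_Suc)
  hence "bernoulli_poly 0 0 = 1"
    by (simp add: bernoulli_poly_1_arg)
  thus ?thesis
    by (subst bernoulli_poly_expand) simp
qed

lemma bernoulli_poly_1: "bernoulli_poly 1 x = x - 1 / 2"
proof -
  have *: "bernoulli_poly 1 x = x + bernoulli_poly 1 0" for x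
    by (subst bernoulli_poly_expand) (simp add: atMost_Suc bernoulli_poly_0)
  show ?thesis
    using *[of "1 / 2"] *[of x] bernoulli_poly_odd_half[of 1] by simp
qed

section \<open>Integration against the cosecant\<close>

text \<open>
  Approximate \<open>g\<close> uniformly by a polynomial \<open>p\<close>. The error contributes little whatever \<open>c\<close> is, and
  integrating \<open>p t cos (c t)\<close> by parts gains a factor \<open>1 / c\<close>.
\<close>

lemma Riemann_Lebesgue_cos:
  fixes g :: "real \<Rightarrow> real"
  assumes cont: "continuous_on {a..b} g"
  shows "((\<lambda>c. integral {a..b} (\<lambda>t. g t * cos (c * t))) \<longlongrightarrow> 0) at_top"
proof (cases "a \<le> b")
  case True
  show ?thesis
  proof (rule tendstoI)
    fix e :: real assume "e > 0"
    \<comment> \<open>The \<open>+ 1\<close> keeps the denominator positive when \<open>a = b\<close>.\<close>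
    define d where "d = e / (2 * (b - a + 1))"
    have d: "d > 0" "d * (b - a) < e / 2"
      using \<open>e > 0\<close> True by (auto simp: d_def field_simps)
    obtain p where p: "real_polynomial_function p" "\<And>t. t \<in> {a..b} \<Longrightarrow> \<bar>g t - p t\<bar> < d"
      using Stone_Weierstrass_real_polynomial_function[OF _ cont d(1)] by auto
    obtain p' where p': "real_polynomial_function p'" "\<And>t. (p has_real_derivative p' t) (at t)"
      using has_real_derivative_polynomial_function[OF p(1)] by auto
    have cp: "continuous_on {a..b} p" and cp': "continuous_on {a..b} p'"
      using p(1) p'(1) by (simp_all add: continuous_on_polymonial_function real_polynomial_function_eq)
    define K where "K = \<bar>p b\<bar> + \<bar>p a\<bar> + integral {a..b} (\<lambda>t. \<bar>p' t\<bar>)"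
    have bound: "\<bar>integral {a..b} (\<lambda>t. g t * cos (c * t))\<bar> \<le> d * (b - a) + K / c" if c: "c > 0" for c
    proof -
      have i1: "(\<lambda>t. (g t - p t) * cos (c * t)) integrable_on {a..b}"
       and i2: "(\<lambda>t. p' t * sin (c * t) / c) integrable_on {a..b}"
       and i3: "(\<lambda>t. \<bar>p' t\<bar> / c) integrable_on {a..b}"
        using c by (auto intro!: integrable_continuous_interval continuous_intros cont cp cp')
      have "((\<lambda>t. p t * cos (c * t) + p' t * sin (c * t) / c) has_integral
          (p b * sin (c * b) / c - p a * sin (c * a) / c)) {a..b}"
        using c by (intro fundamental_theorem_of_calculus True)
          (auto intro!: derivative_eq_intros has_field_derivative_at_within[OF p'(2)]
                simp: has_real_derivative_iff_has_vector_derivative[symmetric] field_simps)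
      from has_integral_diff[OF this integrable_integral[OF i2]]
      have P: "((\<lambda>t. p t * cos (c * t)) has_integral (p b * sin (c * b) / c - p a * sin (c * a) / c
             - integral {a..b} (\<lambda>t. p' t * sin (c * t) / c))) {a..b}"
        by simp
      from has_integral_add[OF integrable_integral[OF i1] P]
      have eq: "integral {a..b} (\<lambda>t. g t * cos (c * t)) =
          integral {a..b} (\<lambda>t. (g t - p t) * cos (c * t)) +
          (p b * sin (c * b) / c - p a * sin (c * a) / c
             - integral {a..b} (\<lambda>t. p' t * sin (c * t) / c))"
        by (intro integral_unique) (simp add: algebra_simps)
      have "norm (integral {a..b} (\<lambda>t. (g t - p t) * cos (c * t))) \<le> integral {a..b} (\<lambda>t. d)"
      proof (rule integral_norm_bound_integral[OF i1])
        fix t assume "t \<in> {a..b}"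
        hence "\<bar>g t - p t\<bar> * \<bar>cos (c * t)\<bar> \<le> d * 1"
          using p(2)[of t] d(1) by (intro mult_mono) auto
        thus "norm ((g t - p t) * cos (c * t)) \<le> d" by (simp add: abs_mult)
      qed auto
      hence b1: "\<bar>integral {a..b} (\<lambda>t. (g t - p t) * cos (c * t))\<bar> \<le> d * (b - a)"
        using True by (simp add: mult.commute)
      have "norm (integral {a..b} (\<lambda>t. p' t * sin (c * t) / c)) \<le> integral {a..b} (\<lambda>t. \<bar>p' t\<bar> / c)"
      proof (rule integral_norm_bound_integral[OF i2 i3])
        fix t
        have "\<bar>p' t\<bar> * \<bar>sin (c * t)\<bar> \<le> \<bar>p' t\<bar> * 1"
          by (intro mult_left_mono) auto
        thus "norm (p' t * sin (c * t) / c) \<le> \<bar>p' t\<bar> / c"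
          using c by (simp add: abs_mult divide_right_mono)
      qed
      hence b2: "\<bar>integral {a..b} (\<lambda>t. p' t * sin (c * t) / c)\<bar> \<le> integral {a..b} (\<lambda>t. \<bar>p' t\<bar>) / c"
        by simp
      have b3: "\<bar>p s * sin (c * s) / c\<bar> \<le> \<bar>p s\<bar> / c" for s
      proof -
        have "\<bar>p s\<bar> * \<bar>sin (c * s)\<bar> \<le> \<bar>p s\<bar> * 1"
          by (intro mult_left_mono) auto
        thus ?thesis using c by (simp add: abs_mult divide_right_mono)
      qed
      have "K / c = \<bar>p b\<bar> / c + \<bar>p a\<bar> / c + integral {a..b} (\<lambda>t. \<bar>p' t\<bar>) / c"
        by (simp add: K_def add_divide_distrib)
      thus ?thesis
        using b1 b2 b3[of a] b3[of b] unfolding eq by linarith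
    qed
    have "((\<lambda>c. K / c) \<longlongrightarrow> 0) at_top"
      by (intro tendsto_divide_0[OF tendsto_const] filterlim_at_top_imp_at_infinity filterlim_ident)
    hence "\<forall>\<^sub>F c in at_top. K / c < e / 2"
      using \<open>e > 0\<close> by (intro order_tendstoD(2)[where y = 0]) auto
    thus "\<forall>\<^sub>F c in at_top. dist (integral {a..b} (\<lambda>t. g t * cos (c * t))) 0 < e"
      using eventually_gt_at_top[of 0]
    proof eventually_elim
      case (elim c)
      thus ?case using bound[OF elim(2)] d(2) unfolding dist_real_def diff_0_right by linarith
    qed
  qed
qed simp

lemma sin_odd_multiples_sum:
  fixes x :: real
  shows "2 * sin x * (\<Sum>j<N. sin (real (2 * j + 1) * x)) = 1 - cos (real (2 * N) * x)"
proof (induction N)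
  case (Suc N)
  have "2 * sin x * sin (real (2 * N + 1) * x) =
      cos (real (2 * N + 1) * x - x) - cos (real (2 * N + 1) * x + x)"
    by (simp add: cos_diff cos_add)
  also have "\<dots> = cos (real (2 * N) * x) - cos (real (2 * Suc N) * x)"
    by (simp add: algebra_simps)
  finally show ?case using Suc by (simp add: distrib_left)
qed simp

text \<open>
  Here \<open>s j\<close> are the sine coefficients of odd index of \<open>f t = g t * sin (\<pi> t)\<close>, so the sum evaluates
  the integral of \<open>f t / sin (\<pi> t)\<close>. Stating it for \<open>g\<close> avoids dividing by the sine at the
  endpoints. The partial sums miss the integral exactly by a cosine integral that
  the Riemann-Lebesgue lemma sends to zero.
\<close>

lemma cosecant_integral_sums:
  fixes g :: "real \<Rightarrow> real"
  assumes cont: "continuous_on {0..1} g"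
    and S: "\<And>j. ((\<lambda>t. g t * sin (pi * t) * sin (real (2 * j + 1) * (pi * t))) has_integral s j) {0..1}"
  shows "(\<lambda>j. 2 * s j) sums integral {0..1} g"
proof -
  define R where "R = (\<lambda>N. integral {0..1} (\<lambda>t. g t * cos ((real (2 * N) * pi) * t)))"
  have partial: "(\<Sum>j<N. 2 * s j) = integral {0..1} g - R N" for N
  proof -
    have "((\<lambda>t. \<Sum>j<N. 2 * (g t * sin (pi * t) * sin (real (2 * j + 1) * (pi * t)))) has_integral
        (\<Sum>j<N. 2 * s j)) {0..1}"
      by (intro has_integral_sum has_integral_mult_right S) auto
    also have "(\<lambda>t. \<Sum>j<N. 2 * (g t * sin (pi * t) * sin (real (2 * j + 1) * (pi * t)))) =
        (\<lambda>t. g t * (2 * sin (pi * t) * (\<Sum>j<N. sin (real (2 * j + 1) * (pi * t)))))"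
      by (simp add: sum_distrib_left mult_ac)
    also have "\<dots> = (\<lambda>t. g t - g t * cos ((real (2 * N) * pi) * t))"
      by (simp only: sin_odd_multiples_sum) (simp add: algebra_simps)
    finally have "((\<lambda>t. g t - g t * cos ((real (2 * N) * pi) * t)) has_integral (\<Sum>j<N. 2 * s j)) {0..1}" .
    moreover have "((\<lambda>t. g t - g t * cos ((real (2 * N) * pi) * t)) has_integral
        (integral {0..1} g - R N)) {0..1}"
      unfolding R_def
      by (intro has_integral_diff integrable_integral integrable_continuous_interval continuous_intros cont)
    ultimately show ?thesis by (rule has_integral_unique)
  qed
  have "filterlim (\<lambda>N. real (2 * N) * pi) at_top sequentially"
    by real_asymp
  hence "R \<longlonglongrightarrow> 0"
    unfolding R_def by (rule filterlim_compose[OF Riemann_Lebesgue_cos[OF cont]])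
  hence "(\<lambda>N. integral {0..1} g - R N) \<longlonglongrightarrow> integral {0..1} g - 0"
    by (intro tendsto_intros)
  thus ?thesis by (simp add: sums_def partial)
qed

lemma tendsto_quotient_of_zeros:
  fixes f h :: "real \<Rightarrow> real"
  assumes "(f has_real_derivative f') (at a)" "(h has_real_derivative h') (at a)"
    and "f a = 0" "h a = 0" "h' \<noteq> 0"
  shows "((\<lambda>t. f t / h t) \<longlongrightarrow> f' / h') (at a)"
proof -
  have "((\<lambda>t. ((f t - f a) / (t - a)) / ((h t - h a) / (t - a))) \<longlongrightarrow> f' / h') (at a)"
    using assms by (intro tendsto_divide) (auto simp: has_field_derivative_iff)
  thus ?thesis
    by (rule Lim_transform_eventually)
       (use assms in \<open>auto simp: eventually_at_filter\<close>)
qed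

text \<open>
  The zeros of the sine at \<open>0\<close> and \<open>1\<close> are simple and are cancelled by those of \<open>f\<close>; the limits
  of the quotient there are the quotients of the derivatives.
\<close>

lemma cosecant_continuous_extension:
  fixes f f' :: "real \<Rightarrow> real"
  assumes deriv: "\<And>t. (f has_real_derivative f' t) (at t)"
    and zeros: "f 0 = 0" "f 1 = 0"
  obtains g where "continuous_on {0..1} g"
    "\<And>t. t \<in> {0<..<1} \<Longrightarrow> g t = f t / sin (pi * t)"
    "\<And>t. t \<in> {0..1} \<Longrightarrow> f t = g t * sin (pi * t)"
proof -
  define g where "g = (\<lambda>t. if t = 0 then f' 0 / pi else if t = 1 then - f' 1 / pi else f t / sin (pi * t))"
  have sin_pos: "sin (pi * t) > 0" if "t \<in> {0<..<1}" for t
    using that by (intro sin_gt_zero) auto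
  have sin_deriv: "((\<lambda>t. sin (pi * t)) has_real_derivative pi * cos (pi * t)) (at t)" for t
    by (auto intro!: derivative_eq_intros)
  have lim0: "(g \<longlongrightarrow> g 0) (at 0)"
  proof (rule Lim_transform_eventually)
    show "((\<lambda>t. f t / sin (pi * t)) \<longlongrightarrow> g 0) (at 0)"
      using tendsto_quotient_of_zeros[OF deriv sin_deriv, of 0] zeros by (simp add: g_def)
    show "\<forall>\<^sub>F t in at 0. f t / sin (pi * t) = g t"
      using eventually_neq_at_within[of 1 0 UNIV] eventually_neq_at_within[of 0 0 UNIV]
      by eventually_elim (simp add: g_def)
  qed
  have lim1: "(g \<longlongrightarrow> g 1) (at 1)"
  proof (rule Lim_transform_eventually)
    show "((\<lambda>t. f t / sin (pi * t)) \<longlongrightarrow> g 1) (at 1)"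
      using tendsto_quotient_of_zeros[OF deriv sin_deriv, of 1] zeros by (simp add: g_def)
    show "\<forall>\<^sub>F t in at 1. f t / sin (pi * t) = g t"
      using eventually_neq_at_within[of 1 1 UNIV] eventually_neq_at_within[of 0 1 UNIV]
      by eventually_elim (simp add: g_def)
  qed
  have lim: "(g \<longlongrightarrow> g a) (at a)" if a: "a \<in> {0<..<1}" for a
  proof (rule Lim_transform_eventually)
    have "((\<lambda>t. f t / sin (pi * t)) \<longlongrightarrow> f a / sin (pi * a)) (at a)"
      using DERIV_isCont[OF deriv[of a]] sin_pos[OF a]
      by (intro tendsto_intros) (auto simp: isCont_def)
    thus "((\<lambda>t. f t / sin (pi * t)) \<longlongrightarrow> g a) (at a)"
      using a by (simp add: g_def)
    show "\<forall>\<^sub>F t in at a. f t / sin (pi * t) = g t"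
      using eventually_neq_at_within[of 1 a UNIV] eventually_neq_at_within[of 0 a UNIV]
      by eventually_elim (simp add: g_def)
  qed
  show ?thesis
  proof (rule that[of g])
    show "continuous_on {0..1} g"
    proof (rule continuous_at_imp_continuous_on, rule ballI)
      fix a :: real assume "a \<in> {0..1}"
      then consider "a = 0" | "a = 1" | "a \<in> {0<..<1}" by force
      thus "isCont g a" using lim0 lim1 lim by cases (auto simp: isCont_def)
    qed
    show "g t = f t / sin (pi * t)" if "t \<in> {0<..<1}" for t
      using that by (auto simp: g_def)
    show "f t = g t * sin (pi * t)" if "t \<in> {0..1}" for t
    proof (cases "t = 0 \<or> t = 1")
      case False
      hence "sin (pi * t) > 0" using that by (intro sin_pos) auto
      thus ?thesis using False by (simp add: g_def)
    qed (use zeros in auto)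
  qed
qed

section \<open>Sine coefficients and the odd part of the zeta series\<close>

lemma has_real_derivative_bernoulli_poly_half:
  "((\<lambda>t. bernoulli_poly (Suc m) ((1 - t) / 2)) has_real_derivative
      - (real (Suc m) / 2) * bernoulli_poly m ((1 - t) / 2)) (at t within A)"
proof (rule has_field_derivative_at_within)
  have "((\<lambda>t. (1 - t) / 2) has_real_derivative (- 1 / 2)) (at t)"
    by (auto intro!: derivative_eq_intros)
  from DERIV_chain2[OF has_real_derivative_bernoulli_poly this]
  show "((\<lambda>t. bernoulli_poly (Suc m) ((1 - t) / 2)) has_real_derivative
      - (real (Suc m) / 2) * bernoulli_poly m ((1 - t) / 2)) (at t)"
    by (simp add: field_simps)
qed

text \<open>
  Two integrations by parts relate the coefficients for \<open>2n+3\<close> and \<open>2n+1\<close>. The boundary terms vanish: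
  the cosine one because \<open>B\<^bsub>2n+3\<^esub>\<close> is zero at \<open>0\<close> and \<open>1 / 2\<close>, the sine one because
  \<open>sin (k \<pi>) = 0\<close>. The parity of \<open>k\<close> matters only at the start, where
  \<open>B\<^sub>1((1 - t) / 2) = - t / 2\<close> leaves the boundary term \<open>cos (k \<pi>) / (2 k \<pi>)\<close>.
\<close>

lemma bernoulli_sine_coefficient:
  fixes k :: nat
  assumes "odd k"
  shows "((\<lambda>t. bernoulli_poly (2 * n + 1) ((1 - t) / 2) * sin (real k * (pi * t))) has_integral
    ((-1) ^ (n + 1) * fact (2 * n + 1) / (2 * pi * real k) ^ (2 * n + 1))) {0..1}"
proof (induction n)
  case 0
  define c where "c = real k * pi"
  have c: "c > 0" using assms by (simp add: c_def odd_pos)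
  have cs: "cos c = -1" "sin c = 0"
    using assms by (simp_all add: c_def)
  have "((\<lambda>t. - (t / 2) * sin (c * t)) has_integral
      ((1 / 2 * cos (c * 1) / c - sin (c * 1) / (2 * c\<^sup>2)) - (0 / 2 * cos (c * 0) / c - sin (c * 0) / (2 * c\<^sup>2)))) {0..1}"
    using c by (intro fundamental_theorem_of_calculus)
      (auto intro!: derivative_eq_intros
        simp: has_real_derivative_iff_has_vector_derivative[symmetric] field_simps power2_eq_square)
  thus ?case using cs
    by (simp add: bernoulli_poly_1[unfolded One_nat_def] c_def field_simps)
next
  case (Suc n)
  define c where "c = real k * pi"
  define f where "f = (\<lambda>m t. bernoulli_poly m ((1 - t) / 2))"
  have c: "c > 0" using assms by (simp add: c_def odd_pos)
  have sin_c: "sin c = 0" by (simp add: c_def)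
  have deriv: "(f (Suc m) has_real_derivative - (real (Suc m) / 2) * f m t) (at t within A)" for m t A
    unfolding f_def by (rule has_real_derivative_bernoulli_poly_half)
  define q where "q = real (2 * n + 3) * real (2 * n + 2) / (2 * c)\<^sup>2"
  define F where "F = (\<lambda>t. - f (2 * n + 3) t * cos (c * t) / c
      - real (2 * n + 3) / (2 * c\<^sup>2) * (f (2 * n + 2) t * sin (c * t)))"
  \<comment> \<open>An antiderivative that performs both integrations by parts at once.\<close>
  have by_parts: "((\<lambda>t. - u t * cos (c * t) / c - p / (2 * c\<^sup>2) * (v t * sin (c * t))) has_real_derivative
      u t * sin (c * t) + p * r / (2 * c)\<^sup>2 * (w t * sin (c * t))) (at t within A)"
    if "(u has_real_derivative - (p / 2) * v t) (at t within A)"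
      "(v has_real_derivative - (r / 2) * w t) (at t within A)" for u v w p r t A
    using c by (auto intro!: derivative_eq_intros that simp: field_simps power2_eq_square)
  have f_ends: "f (2 * n + 3) 0 = 0" "f (2 * n + 3) 1 = 0"
    by (simp_all add: f_def bernoulli_poly_odd_half bernoulli_poly_odd_0)
  have "((\<lambda>t. f (2 * n + 3) t * sin (c * t) + q * (f (2 * n + 1) t * sin (c * t)))
      has_integral (F 1 - F 0)) {0..1}"
  proof (rule fundamental_theorem_of_calculus)
    fix t :: real
    have d3: "(f (2 * n + 3) has_real_derivative - (real (2 * n + 3) / 2) * f (2 * n + 2) t) (at t within {0..1})"
      using deriv[of "2 * n + 2" t] by (simp add: numeral_3_eq_3)
    have d2: "(f (2 * n + 2) has_real_derivative - (real (2 * n + 2) / 2) * f (2 * n + 1) t) (at t within {0..1})"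
      using deriv[of "2 * n + 1" t] by simp
    have "(F has_real_derivative f (2 * n + 3) t * sin (c * t) + q * (f (2 * n + 1) t * sin (c * t)))
        (at t within {0..1})"
      unfolding F_def q_def by (rule by_parts[where u = "f (2 * n + 3)" and v = "f (2 * n + 2)" and w = "f (2 * n + 1)",
            OF d3 d2])
    thus "(F has_vector_derivative f (2 * n + 3) t * sin (c * t) + q * (f (2 * n + 1) t * sin (c * t)))
        (at t within {0..1})"
      by (simp add: has_real_derivative_iff_has_vector_derivative)
  qed simp
  moreover have "F 1 - F 0 = 0"
    by (simp add: F_def f_ends sin_c)
  ultimately have "((\<lambda>t. f (2 * n + 3) t * sin (c * t) + q * (f (2 * n + 1) t * sin (c * t)))
      has_integral 0) {0..1}" by simp
  moreover have "((\<lambda>t. q * (f (2 * n + 1) t * sin (c * t))) has_integral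
      q * ((-1) ^ (n + 1) * fact (2 * n + 1) / (2 * c) ^ (2 * n + 1))) {0..1}"
    using Suc by (intro has_integral_mult_right) (simp add: f_def c_def mult_ac)
  ultimately have "((\<lambda>t. f (2 * n + 3) t * sin (c * t)) has_integral
      0 - q * ((-1) ^ (n + 1) * fact (2 * n + 1) / (2 * c) ^ (2 * n + 1))) {0..1}"
    by (auto dest: has_integral_diff)
  also have "0 - q * ((-1) ^ (n + 1) * fact (2 * n + 1) / (2 * c) ^ (2 * n + 1)) =
      (-1) ^ (Suc n + 1) * fact (2 * Suc n + 1) / (2 * c) ^ (2 * Suc n + 1)"
  proof -
    have "(2 * c) ^ (2 * Suc n + 1) = (2 * c)\<^sup>2 * (2 * c) ^ (2 * n + 1)"
      by (simp add: power2_eq_square)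
    moreover have "fact (2 * Suc n + 1) = real (2 * n + 3) * real (2 * n + 2) * fact (2 * n + 1)"
      by (simp add: algebra_simps)
    ultimately show ?thesis using c by (simp add: q_def power2_eq_square mult_ac del: fact_Suc)
  qed
  finally show ?case
    by (simp add: f_def c_def mult_ac numeral_3_eq_3)
qed

lemma zeta_sums:
  assumes "s > 1"
  shows "(\<lambda>k. 1 / real (Suc k) powr s) sums zeta s"
proof -
  have "summable (\<lambda>k. real k powr - s)"
    using assms by (simp add: summable_real_powr_iff)
  hence "summable (\<lambda>k. real (Suc k) powr - s)"
    by (subst summable_Suc_iff)
  thus ?thesis
    unfolding zeta_def by (intro summable_sums) (simp add: powr_minus divide_inverse)
qed

text \<open>
  The even-indexed terms \<open>1 / (2 k)\<^sup>s\<close> make up \<open>2\<^bsup>-s\<^esup>\<close> times the whole series.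
\<close>

lemma zeta_odd_part_sums:
  assumes "s > 1"
  shows "(\<lambda>j. 1 / real (2 * j + 1) powr s) sums ((1 - 2 powr - s) * zeta s)"
proof -
  define a where "a = (\<lambda>k. 1 / real (Suc k) powr s)"
  have a: "a sums zeta s"
    unfolding a_def by (rule zeta_sums[OF assms])
  have "(\<lambda>j. a (2 * j) + a (2 * j + 1)) sums zeta s"
    using sums_group[OF a, of 2] by (simp add: mult.commute)
  moreover have "a (2 * j + 1) = 2 powr - s * a j" for j
  proof -
    have "real (Suc (2 * j + 1)) = 2 * real (Suc j)" by simp
    thus ?thesis
      by (simp only: a_def powr_mult powr_minus) (simp add: field_simps)
  qed
  ultimately have "(\<lambda>j. a (2 * j) + 2 powr - s * a j) sums zeta s" by simp
  from sums_diff[OF this sums_mult[OF a, of "2 powr - s"]] show ?thesis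
    by (simp add: a_def algebra_simps)
qed

section \<open>The integral representation\<close>

theorem mainTheorem12:
  fixes n :: nat
  assumes "n \<ge> 1"
  shows "((\<lambda>t::real. bernoulli_poly (2 * n + 1) ((1 - t) / 2) / sin (pi * t)) has_integral
          ((-1) ^ (n + 1) * fact (2 * n + 1) * (2 - 2 powi (- 2 * int n))
             * (zeta (real (2 * n + 1)) / (2 * pi) ^ (2 * n + 1)))) {0..1}"
proof -
  define m where "m = 2 * n + 1"
  define f where "f = (\<lambda>t. bernoulli_poly m ((1 - t) / 2))"
  define C where "C = ((-1) ^ (n + 1) * fact m / (2 * pi) ^ m :: real)"
  have f0: "f 0 = 0" and f1: "f 1 = 0"
    using assms by (simp_all add: f_def m_def bernoulli_poly_odd_half bernoulli_poly_odd_0)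
  have deriv: "(f has_real_derivative - (real m / 2) * bernoulli_poly (2 * n) ((1 - t) / 2)) (at t)" for t
    unfolding f_def m_def using has_real_derivative_bernoulli_poly_half[of "2 * n"] by simp
  obtain g where g: "continuous_on {0..1} g"
    "\<And>t. t \<in> {0<..<1} \<Longrightarrow> g t = f t / sin (pi * t)"
    "\<And>t. t \<in> {0..1} \<Longrightarrow> f t = g t * sin (pi * t)"
    using cosecant_continuous_extension[OF deriv f0 f1] by blast
  have coeff: "((\<lambda>t. g t * sin (pi * t) * sin (real (2 * j + 1) * (pi * t))) has_integral
      C * (1 / real (2 * j + 1) powr real m)) {0..1}" for j
  proof -
    have "((\<lambda>t. f t * sin (real (2 * j + 1) * (pi * t))) has_integral
        (-1) ^ (n + 1) * fact m / (2 * pi * real (2 * j + 1)) ^ m) {0..1}"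
      unfolding f_def m_def by (rule bernoulli_sine_coefficient) simp
    also have "(-1) ^ (n + 1) * fact m / (2 * pi * real (2 * j + 1)) ^ m =
        C * (1 / real (2 * j + 1) powr real m)"
      by (simp add: C_def powr_realpow power_mult_distrib del: of_nat_add of_nat_mult)
    finally show ?thesis
      by (rule has_integral_eq[rotated]) (use g(3) in simp)
  qed
  have "(\<lambda>j. 2 * (C * (1 / real (2 * j + 1) powr real m))) sums integral {0..1} g"
    by (rule cosecant_integral_sums[OF g(1) coeff])
  moreover have "(\<lambda>j. 2 * (C * (1 / real (2 * j + 1) powr real m))) sums
      (2 * (C * ((1 - 2 powr - real m) * zeta (real m))))"
    using assms by (intro sums_mult zeta_odd_part_sums) (simp add: m_def)
  ultimately have "integral {0..1} g = 2 * (C * ((1 - 2 powr - real m) * zeta (real m)))"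
    by (rule sums_unique2)
  also have "\<dots> = C * (2 - 2 powi (- 2 * int n)) * zeta (real m)"
  proof -
    have "2 powi (- 2 * int n) = 2 powr (real_of_int (- 2 * int n))"
      by (rule powr_real_of_int'[symmetric]) auto
    also have "\<dots> = 2 powr (1 + - real m)" by (simp add: m_def)
    also have "\<dots> = 2 * 2 powr - real m" by (subst powr_add) simp
    finally show ?thesis by (simp add: algebra_simps)
  qed
  finally have "(g has_integral C * (2 - 2 powi (- 2 * int n)) * zeta (real m)) {0..1}"
    using integrable_integral[OF integrable_continuous_interval[OF g(1)]] by simp
  \<comment> \<open>At the endpoints the quotient has the default value \<open>0\<close>, which may differ from \<open>g\<close>.\<close>
  hence "((\<lambda>t. f t / sin (pi * t)) has_integral C * (2 - 2 powi (- 2 * int n)) * zeta (real m)) {0..1}"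
    by (rule has_integral_spike_finite[rotated 2, where S = "{0, 1}"]) (use g(2) in auto)
  thus ?thesis
    by (simp add: f_def C_def m_def)
qed

end
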